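(* Let $G(\lambda)\in\mathbb F(\lambda)^{p\times m}$ and let $P(\lambda)=\begin{bmatrix} A(\lambda) & B(\lambda)\\ -C(\lambda) & D(\lambda)\end{bmatrix}$ be a polynomial system matrix of $G(\lambda)$. (a) If $A(\lambda)$ and $C(\lambda)$ are right coprime, $A(\lambda)^{-1}B(\lambda)$ is proper, $H_2(\lambda)$ is a right minimal basis of $G(\lambda)$ and $H_1(\lambda)=-A(\lambda)^{-1}B(\lambda)H_2(\lambda)$, then $\begin{bmatrix}H_1(\lambda)\\H_2(\lambda)\end{bmatrix}$ is a right minimal basis of $P(\lambda)$. Moreover, the right minimal indices of $P(\lambda)$ and $G(\lambda)$ are the same. (b) If $A(\lambda)$ and $B(\lambda)$ are left coprime, $C(\lambda)A(\lambda)^{-1}$ is proper, $H_2(\lambda)$ is a left minimal basis of $G(\lambda)$ and $H_1(\lambda)=(C(\lambda)A(\lambda)^{-1})^TH_2(\lambda)$, then $\begin{bmatrix}H_1(\lambda)\\H_2(\lambda)\end{bmatrix}$ is a left minimal basis of $P(\lambda)$. Moreover, the left minimal indices of $P(\lambda)$ and $G(\lambda)$ are the same.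
   Context: $\mathbb F$ is an arbitrary field, $\overline{\mathbb F}$ its algebraic closure. A polynomial system matrix of $G(\lambda)\in\mathbb F(\lambda)^{p\times m}$ is $P(\lambda)=\begin{bmatrix} A(\lambda) & B(\lambda)\\ -C(\lambda) & D(\lambda)\end{bmatrix}$ with $A\in\mathbb F[\lambda]^{n\times n}$ regular, $B\in\mathbb F[\lambda]^{n\times m}$, $C\in\mathbb F[\lambda]^{p\times n}$, $D\in\mathbb F[\lambda]^{p\times m}$, and $G=D+CA^{-1}B$. $A,C$ are right coprime if all common right divisors are unimodular (equivalently $\begin{bmatrix}A(\lambda_0)\\ C(\lambda_0)\end{bmatrix}$ has full column rank for all $\lambda_0\in\overline{\mathbb F}$); $A,B$ are left coprime if $A^T,B^T$ are right coprime. A rational matrix is proper if each entry has numerator degree at most denominator degree. For a subspace of $\mathbb F(\lambda)^k$, a minimal basis is a polynomial basis minimizing the sum of the degrees of its vectors, and the minimal indices are the degrees of its vectors. A polynomial matrix is a right (left) minimal basis of a rational matrix $G$ if its columns form a minimal basis of $\mathcal N_r(G)=\{x:Gx=0\}$ ($\mathcal N_\ell(G)=\{x:x^TG=0\}$); the right (left) minimal indices of $G$ are those of $\mathcal N_r(G)$ ($\mathcal N_\ell(G)$). *)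

theory Defs
  imports "Jordan_Normal_Form.Determinant"
    "HOL-Computational_Algebra.Polynomial"
    "HOL-Computational_Algebra.Fraction_Field"
    "HOL-Library.Multiset"
begin

definition rat_of_poly :: "'a::field poly \<Rightarrow> 'a poly fract" where
  "rat_of_poly p = Fract p 1"

definition rmat :: "'a::field poly mat \<Rightarrow> 'a poly fract mat" where
  "rmat M = map_mat rat_of_poly M"

definition inv_mat :: "'b::field mat \<Rightarrow> 'b mat" where
  "inv_mat A = (SOME B. B \<in> carrier_mat (dim_row A) (dim_row A) \<and>
      A * B = 1\<^sub>m (dim_row A) \<and> B * A = 1\<^sub>m (dim_row A))"

definition regular_pmat :: "'a::field poly mat \<Rightarrow> bool" where
  "regular_pmat A \<longleftrightarrow> square_mat A \<and> det A \<noteq> 0"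

text \<open>Unimodular: square polynomial matrix with polynomial inverse
  (equivalently determinant a nonzero constant).\<close>
definition unimodular :: "'a::field poly mat \<Rightarrow> bool" where
  "unimodular U \<longleftrightarrow> invertible_mat U"

definition common_right_divisor :: "'a::field poly mat \<Rightarrow> 'a poly mat \<Rightarrow> 'a poly mat \<Rightarrow> bool" where
  "common_right_divisor A C W \<longleftrightarrow> W \<in> carrier_mat (dim_col A) (dim_col A) \<and>
     (\<exists>A' C'. A' \<in> carrier_mat (dim_row A) (dim_col A) \<and> C' \<in> carrier_mat (dim_row C) (dim_col A)
        \<and> A = A' * W \<and> C = C' * W)"

definition right_coprime :: "'a::field poly mat \<Rightarrow> 'a poly mat \<Rightarrow> bool" where
  "right_coprime A C \<longleftrightarrow> (\<forall>W. common_right_divisor A C W \<longrightarrow> unimodular W)"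

definition left_coprime :: "'a::field poly mat \<Rightarrow> 'a poly mat \<Rightarrow> bool" where
  "left_coprime A B \<longleftrightarrow> right_coprime (transpose_mat A) (transpose_mat B)"

text \<open>Proper rational function: numerator degree at most denominator degree
  (independent of the chosen representation).\<close>
definition proper_rat :: "'a::field poly fract \<Rightarrow> bool" where
  "proper_rat r \<longleftrightarrow> (\<exists>p q. q \<noteq> 0 \<and> r = Fract p q \<and> degree p \<le> degree q)"

definition proper_mat :: "'a::field poly fract mat \<Rightarrow> bool" where
  "proper_mat M \<longleftrightarrow> (\<forall>i < dim_row M. \<forall>j < dim_col M. proper_rat (M $$ (i,j)))"

definition system_matrix :: "'a::field poly mat \<Rightarrow> 'a poly mat \<Rightarrow> 'a poly mat \<Rightarrow> 'a poly mat \<Rightarrow> 'a poly mat" where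
  "system_matrix A B C D = four_block_mat A B (- C) D"

definition is_system_matrix_of ::
  "'a::field poly fract mat \<Rightarrow> 'a poly mat \<Rightarrow> 'a poly mat \<Rightarrow> 'a poly mat \<Rightarrow> 'a poly mat \<Rightarrow> nat \<Rightarrow> nat \<Rightarrow> nat \<Rightarrow> bool" where
  "is_system_matrix_of G A B C D n m p \<longleftrightarrow>
     A \<in> carrier_mat n n \<and> B \<in> carrier_mat n m \<and> C \<in> carrier_mat p n \<and> D \<in> carrier_mat p m \<and>
     regular_pmat A \<and> G = rmat D + rmat C * inv_mat (rmat A) * rmat B"

definition right_null :: "'b::field mat \<Rightarrow> 'b vec set" where
  "right_null M = {x \<in> carrier_vec (dim_col M). M *\<^sub>v x = 0\<^sub>v (dim_row M)}"

definition left_null :: "'b::field mat \<Rightarrow> 'b vec set" where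
  "left_null M = right_null (transpose_mat M)"

definition poly_basis :: "nat \<Rightarrow> 'a::field poly fract vec set \<Rightarrow> 'a poly mat \<Rightarrow> bool" where
  "poly_basis k S H \<longleftrightarrow> dim_row H = k \<and>
     (\<forall>j < dim_col H. col (rmat H) j \<in> S) \<and>
     (\<forall>x \<in> carrier_vec (dim_col H). rmat H *\<^sub>v x = 0\<^sub>v k \<longrightarrow> x = 0\<^sub>v (dim_col H)) \<and>
     (\<forall>v \<in> S. \<exists>x \<in> carrier_vec (dim_col H). v = rmat H *\<^sub>v x)"

definition col_degree :: "'a::field poly mat \<Rightarrow> nat \<Rightarrow> nat" where
  "col_degree H j = Max (insert 0 {degree (H $$ (i, j)) | i. i < dim_row H})"

definition degree_sum :: "'a::field poly mat \<Rightarrow> nat" where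
  "degree_sum H = (\<Sum>j < dim_col H. col_degree H j)"

definition minimal_basis :: "nat \<Rightarrow> 'a::field poly fract vec set \<Rightarrow> 'a poly mat \<Rightarrow> bool" where
  "minimal_basis k S H \<longleftrightarrow> poly_basis k S H \<and>
     (\<forall>H'. poly_basis k S H' \<longrightarrow> degree_sum H \<le> degree_sum H')"

definition minimal_indices :: "nat \<Rightarrow> 'a::field poly fract vec set \<Rightarrow> nat multiset" where
  "minimal_indices k S = (let H = (SOME H. minimal_basis k S H) in
     mset (map (col_degree H) [0..<dim_col H]))"

definition right_minimal_basis :: "'a::field poly fract mat \<Rightarrow> 'a poly mat \<Rightarrow> bool" where
  "right_minimal_basis G H \<longleftrightarrow> minimal_basis (dim_col G) (right_null G) H"

definition left_minimal_basis :: "'a::field poly fract mat \<Rightarrow> 'a poly mat \<Rightarrow> bool" where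
  "left_minimal_basis G H \<longleftrightarrow> minimal_basis (dim_row G) (left_null G) H"

definition right_minimal_indices :: "'a::field poly fract mat \<Rightarrow> nat multiset" where
  "right_minimal_indices G = minimal_indices (dim_col G) (right_null G)"

definition left_minimal_indices :: "'a::field poly fract mat \<Rightarrow> nat multiset" where
  "left_minimal_indices G = minimal_indices (dim_row G) (left_null G)"

end

theory Submission
  imports Defs
begin

text \<open>
  With \<open>K = A\<inverse>B\<close>, the map \<open>x \<mapsto> (-K x, x)\<close> is an isomorphism from the right null space of \<open>G\<close>
  to that of \<open>P\<close>. If \<open>x\<close> is polynomial, then so are \<open>A(-K x) = -B x\<close> and \<open>C(-K x) = D x\<close>, and right
  coprimeness of \<open>A\<close> and \<open>C\<close> forces \<open>-K x\<close> to be polynomial: a vector \<open>g / q\<close> in lowest terms with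
  \<open>A g / q\<close> and \<open>C g / q\<close> polynomial would yield a common right divisor of determinant \<open>q\<close>. Hence
  polynomial bases of the two null spaces correspond to each other, and properness of \<open>K\<close> makes the
  column degrees agree, so minimal bases correspond as well. That the minimal indices do not depend
  on the chosen minimal basis is an exchange argument: if \<open>H' = H X\<close> for minimal bases, then
  \<open>X\<^sub>i\<^sub>j \<noteq> 0\<close> implies that column \<open>i\<close> of \<open>H\<close> has at most the degree of column \<open>j\<close> of \<open>H'\<close>, and a
  nonzero term of \<open>det X\<close> matches the columns of both bases. Part (b) is part (a) for the
  transposed system \<open>(A\<^sup>T, -C\<^sup>T, -B\<^sup>T, D\<^sup>T)\<close>.
\<close>

section \<open>Polynomials inside the rational functions\<close>

text \<open>Makes the transfer rules for injective ring homomorphisms on vectors, matrices and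
  determinants available for \<open>rat_of_poly\<close>.\<close>

interpretation rat_of_poly: inj_comm_ring_hom "rat_of_poly :: 'a::field poly \<Rightarrow> 'a poly fract"
  by unfold_locales (auto simp: rat_of_poly_def eq_fract Zero_fract_def One_fract_def)

lemma rmat_carrier [simp]: "rmat M \<in> carrier_mat nr nc \<longleftrightarrow> M \<in> carrier_mat nr nc"
  by (simp add: rmat_def)

lemma dim_rmat [simp]: "dim_row (rmat M) = dim_row M" "dim_col (rmat M) = dim_col M"
  by (simp_all add: rmat_def)

lemma col_rmat [simp]: "j < dim_col M \<Longrightarrow> col (rmat M) j = map_vec rat_of_poly (col M j)"
  by (simp add: rmat_def)

lemma rmat_mult:
  "A \<in> carrier_mat nr n \<Longrightarrow> B \<in> carrier_mat n nc \<Longrightarrow> rmat (A * B) = rmat A * rmat B"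
  unfolding rmat_def by (rule rat_of_poly.mat_hom_mult)

lemma rmat_mult_vec:
  "A \<in> carrier_mat nr n \<Longrightarrow> v \<in> carrier_vec n \<Longrightarrow>
    map_vec rat_of_poly (A *\<^sub>v v) = rmat A *\<^sub>v map_vec rat_of_poly v"
  unfolding rmat_def by (rule rat_of_poly.mult_mat_vec_hom)

lemma rmat_uminus: "rmat (- M) = - rmat M"
  by (rule eq_matI) (auto simp: rmat_def rat_of_poly.hom_uminus)

lemma rmat_transpose: "rmat (transpose_mat M) = transpose_mat (rmat M)"
  by (simp add: rmat_def map_mat_transpose)

section \<open>Determinants, column replacement and dimension\<close>

lemma det_nonzero_inverse:
  fixes A :: "'b::field mat"
  assumes A: "A \<in> carrier_mat n n" and "det A \<noteq> 0"
  obtains B where "B \<in> carrier_mat n n" "A * B = 1\<^sub>m n" "B * A = 1\<^sub>m n"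
  using det_non_zero_imp_unit[OF assms, of undefined]
  by (auto simp: Units_def ring_mat_def)

lemma det_replace_col_one:
  fixes x :: "'b::comm_ring_1 vec"
  assumes "x \<in> carrier_vec n" "j < n"
  shows "det (replace_col (1\<^sub>m n) x j) = x $ j"
  using cramer_lemma_mat[of "1\<^sub>m n" n x j] assms by simp

text \<open>Expresses the replacement of one column as a right multiplication. Both the exchange of
  basis vectors and the construction of right divisors rest on it.\<close>

lemma mult_replace_col_one:
  fixes A :: "'b::comm_ring_1 mat"
  assumes A: "A \<in> carrier_mat k n" and x: "x \<in> carrier_vec n" and j: "j < n"
  shows "A * replace_col (1\<^sub>m n) x j = replace_col A (A *\<^sub>v x) j"
proof (rule eq_matI)
  fix i l assume "i < dim_row (replace_col A (A *\<^sub>v x) j)" "l < dim_col (replace_col A (A *\<^sub>v x) j)"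
  then have il: "i < k" "l < n" using A by (auto simp: replace_col_def)
  have "col (replace_col (1\<^sub>m n) x j) l = (if l = j then x else unit_vec n l)"
    using x il by (intro eq_vecI) (auto simp: replace_col_def)
  then show "(A * replace_col (1\<^sub>m n) x j) $$ (i, l) = replace_col A (A *\<^sub>v x) j $$ (i, l)"
    using A x j il by (auto simp: replace_col_def row_def)
qed (use A in \<open>auto simp: replace_col_def\<close>)

text \<open>Invariance of dimension. Applied in both directions, it makes the transition matrices
  between two bases square.\<close>

lemma left_inverse_dim_le:
  fixes X Y :: "'b::field mat"
  assumes X: "X \<in> carrier_mat r s" and Y: "Y \<in> carrier_mat s r" and YX: "Y * X = 1\<^sub>m s"
  shows "s \<le> r"
proof (rule ccontr)
  assume "\<not> s \<le> r"
  then have rs: "r < s" by simp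
  \<comment> \<open>after padding to size \<open>s\<close>, the last row of \<open>X'\<close> vanishes although \<open>Y' * X' = 1\<close>\<close>
  define X' where "X' = mat s s (\<lambda>(i,j). if i < r then X $$ (i,j) else 0)"
  define Y' where "Y' = mat s s (\<lambda>(i,j). if j < r then Y $$ (i,j) else 0)"
  have c: "X' \<in> carrier_mat s s" "Y' \<in> carrier_mat s s" by (auto simp: X'_def Y'_def)
  have "Y' * X' = 1\<^sub>m s"
  proof (rule eq_matI)
    fix i j assume "i < dim_row (1\<^sub>m s :: 'b mat)" "j < dim_col (1\<^sub>m s :: 'b mat)"
    then have ij: "i < s" "j < s" by auto
    have "(Y' * X') $$ (i, j) = (\<Sum>l = 0..<s. Y' $$ (i,l) * X' $$ (l,j))"
      using c ij by (simp add: scalar_prod_def)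
    also have "\<dots> = (\<Sum>l = 0..<s. if l < r then Y $$ (i,l) * X $$ (l,j) else 0)"
      using ij by (intro sum.cong) (auto simp: X'_def Y'_def)
    also have "\<dots> = (\<Sum>l = 0..<r. Y $$ (i,l) * X $$ (l,j))"
      using rs by (intro sum.mono_neutral_cong_right) auto
    also have "\<dots> = (Y * X) $$ (i, j)" using X Y ij by (simp add: scalar_prod_def)
    finally show "(Y' * X') $$ (i, j) = 1\<^sub>m s $$ (i, j)" by (simp add: YX)
  qed (use c in auto)
  then have "det Y' * det X' = 1" using det_mult[OF c(2,1)] by simp
  \<comment> \<open>Every Leibniz product contains a factor from row \<open>r\<close> of
    \<open>X'\<close>, which is one of the zero rows added by the padding.\<close>
  moreover have "(\<Prod>i = 0..<s. X' $$ (i, \<sigma> i)) = 0" if "\<sigma> permutes {0..<s}" for \<sigma>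
  proof (rule prod_zero)
    show "\<exists>i\<in>{0..<s}. X' $$ (i, \<sigma> i) = 0"
      using rs permutes_in_image[OF that, of r] by (intro bexI[of _ r]) (auto simp: X'_def)
  qed simp
  then have "det X' = 0" using det_def'[OF c(1)] by (simp add: sum.neutral)
  ultimately show False by simp
qed

section \<open>Polynomial bases and uniqueness of the minimal indices\<close>

text \<open>Linear independence of the columns lets \<open>H\<close> be cancelled on the left. This
  will show that two transition matrices are inverse to each other.\<close>

lemma poly_basis_cancel:
  assumes H: "poly_basis k S H" "H \<in> carrier_mat k r"
    and X: "X \<in> carrier_mat r c" and Y: "Y \<in> carrier_mat r c"
    and eq: "rmat H * X = rmat H * Y"
  shows "X = Y"
proof (rule mat_col_eqI)
  fix j assume "j < dim_col Y"
  then have j: "j < c" using Y by auto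
  have dH: "rmat H \<in> carrier_mat k r" using H(2) by simp
  have cX: "col X j \<in> carrier_vec r" and cY: "col Y j \<in> carrier_vec r"
    using X Y j by auto
  have "rmat H *\<^sub>v col X j = rmat H *\<^sub>v col Y j"
    unfolding col_mult2[OF dH X j, symmetric] col_mult2[OF dH Y j, symmetric] eq ..
  then have "rmat H *\<^sub>v (col X j - col Y j) = 0\<^sub>v k"
    using dH cX cY by (simp add: mult_minus_distrib_mat_vec)
  then have "col X j - col Y j = 0\<^sub>v r"
    using H cX cY unfolding poly_basis_def by auto
  then have "(col X j - col Y j) $ i = 0" if "i < r" for i using that by simp
  then show "col X j = col Y j" using X Y cX cY by (intro eq_vecI) auto
qed (use X Y in auto)

lemma poly_basis_transition:
  assumes H: "poly_basis k S H" "H \<in> carrier_mat k r"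
    and H': "poly_basis k S H'" "H' \<in> carrier_mat k s"
  obtains X where "X \<in> carrier_mat r s" "rmat H' = rmat H * X"
proof -
  have "\<exists>x. x \<in> carrier_vec r \<and> col (rmat H') j = rmat H *\<^sub>v x" if "j < s" for j
    using H(1) H' that carrier_matD(2)[OF H(2)] unfolding poly_basis_def by auto
  then obtain x where x: "\<And>j. j < s \<Longrightarrow> x j \<in> carrier_vec r"
      "\<And>j. j < s \<Longrightarrow> col (rmat H') j = rmat H *\<^sub>v x j"
    by metis
  define X where "X = mat r s (\<lambda>(i,j). x j $ i)"
  have cX: "X \<in> carrier_mat r s" by (simp add: X_def)
  have dH: "rmat H \<in> carrier_mat k r" "rmat H' \<in> carrier_mat k s"
    using H H' by auto
  have colX: "col X j = x j" if "j < s" for j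
    using x(1)[OF that] that by (intro eq_vecI) (auto simp: X_def)
  have "rmat H' = rmat H * X"
  proof (rule mat_col_eqI)
    fix j assume "j < dim_col (rmat H * X)"
    then have j: "j < s" using cX by simp
    show "col (rmat H') j = col (rmat H * X) j"
      unfolding col_mult2[OF dH(1) cX j] colX[OF j] by (rule x(2)[OF j])
  qed (use dH cX in auto)
  then show ?thesis using that cX by blast
qed

text \<open>Steinitz exchange. The new matrix is \<open>H * E\<close>, where \<open>E\<close> is the
  identity with column \<open>j\<close> replaced by the coordinates \<open>x\<close> of
  \<open>v\<close>. Since \<open>det E\<close> is the nonzero entry \<open>x $ j\<close>,
  \<open>E\<close> is invertible over the rational functions, so independence and span are
  preserved.\<close>

lemma poly_basis_replace_col:
  assumes H: "poly_basis k S H" and cH: "H \<in> carrier_mat k r" and j: "j < r"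
    and v: "v \<in> carrier_vec k" "map_vec rat_of_poly v \<in> S"
    and x: "x \<in> carrier_vec r" "map_vec rat_of_poly v = rmat H *\<^sub>v x" "x $ j \<noteq> 0"
  shows "poly_basis k S (replace_col H v j)"
proof -
  define E where "E = replace_col (1\<^sub>m r) x j"
  have E: "E \<in> carrier_mat r r" by (simp add: E_def replace_col_def)
  have "det E \<noteq> 0" using det_replace_col_one[OF x(1) j] x(3) by (simp add: E_def)
  from det_nonzero_inverse[OF E this]
  obtain F where F: "F \<in> carrier_mat r r" "E * F = 1\<^sub>m r" "F * E = 1\<^sub>m r" by blast
  have dH: "rmat H \<in> carrier_mat k r" using cH by simp
  have HE: "rmat (replace_col H v j) = rmat H * E"
  proof -
    have "rmat H * E = replace_col (rmat H) (map_vec rat_of_poly v) j"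
      unfolding E_def x(2) by (rule mult_replace_col_one[OF dH x(1) j])
    also have "\<dots> = rmat (replace_col H v j)"
      using cH v(1) by (intro eq_matI) (auto simp: replace_col_def rmat_def)
    finally show ?thesis ..
  qed
  have dims: "dim_row (replace_col H v j) = k" "dim_col (replace_col H v j) = r"
    using cH by (auto simp: replace_col_def)
  show ?thesis unfolding poly_basis_def dims HE
  proof (intro conjI allI impI ballI)
    fix i assume i: "i < r"
    have "col (replace_col H v j) i = (if i = j then v else col H i)"
      using i cH v(1) by (intro eq_vecI) (auto simp: replace_col_def)
    then show "col (rmat H * E) i \<in> S"
      using v(2) H cH i by (auto simp: HE[symmetric] dims poly_basis_def)
  next
    fix y assume y: "y \<in> carrier_vec r" "rmat H * E *\<^sub>v y = 0\<^sub>v k"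
    then have "rmat H *\<^sub>v (E *\<^sub>v y) = 0\<^sub>v k"
      using assoc_mult_mat_vec[OF dH E y(1)] by simp
    moreover have "E *\<^sub>v y \<in> carrier_vec r" using E y by simp
    ultimately have "E *\<^sub>v y = 0\<^sub>v r"
      using H cH unfolding poly_basis_def by auto
    then have "F *\<^sub>v (E *\<^sub>v y) = 0\<^sub>v r" using F(1) by auto
    then show "y = 0\<^sub>v r" using assoc_mult_mat_vec[OF F(1) E y(1)] F(3) y(1) by simp
  next
    fix w assume "w \<in> S"
    then obtain y where y: "y \<in> carrier_vec r" "w = rmat H *\<^sub>v y"
      using H cH unfolding poly_basis_def by auto
    have Fy: "F *\<^sub>v y \<in> carrier_vec r" using F y by simp
    have "rmat H * E *\<^sub>v (F *\<^sub>v y) = rmat H *\<^sub>v (E *\<^sub>v (F *\<^sub>v y))"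
      by (rule assoc_mult_mat_vec[OF dH E Fy])
    also have "\<dots> = w"
      using assoc_mult_mat_vec[OF E F(1) y(1)] F(2) y by simp
    finally show "\<exists>y\<in>carrier_vec r. w = rmat H * E *\<^sub>v y"
      using Fy by (intro bexI[of _ "F *\<^sub>v y"]) simp_all
  qed simp
qed

text \<open>Otherwise replacing column \<open>i\<close> of \<open>H\<close> by column \<open>j\<close> of \<open>H'\<close> would give a polynomial basis
  of smaller degree sum.\<close>

lemma minimal_basis_exchange:
  assumes H: "minimal_basis k S H" "H \<in> carrier_mat k r"
    and H': "poly_basis k S H'" "H' \<in> carrier_mat k s"
    and X: "X \<in> carrier_mat r s" "rmat H' = rmat H * X"
    and i: "i < r" and j: "j < s" and nz: "X $$ (i, j) \<noteq> 0"
  shows "col_degree H i \<le> col_degree H' j"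
proof -
  let ?R = "replace_col H (col H' j) i"
  have pH: "poly_basis k S H" using H(1) by (simp add: minimal_basis_def)
  have dH: "rmat H \<in> carrier_mat k r" using H(2) by simp
  have "poly_basis k S ?R"
  proof (rule poly_basis_replace_col[OF pH H(2) i, of _ "col X j"])
    show "map_vec rat_of_poly (col H' j) \<in> S" using H' j by (auto simp: poly_basis_def)
    have "map_vec rat_of_poly (col H' j) = col (rmat H') j" using j H'(2) by simp
    also have "\<dots> = col (rmat H * X) j" by (simp only: X(2))
    also have "\<dots> = rmat H *\<^sub>v col X j" by (rule col_mult2[OF dH X(1) j])
    finally show "map_vec rat_of_poly (col H' j) = rmat H *\<^sub>v col X j" .
  qed (use H'(2) X(1) i j nz in auto)
  then have "degree_sum H \<le> degree_sum ?R" using H(1) by (simp add: minimal_basis_def)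
  moreover have "col_degree ?R l = (if l = i then col_degree H' j else col_degree H l)"
    if l: "l < r" for l
  proof -
    have "{degree (?R $$ (a, l)) |a. a < dim_row ?R}
        = {degree (if l = i then H' $$ (a, j) else H $$ (a, l)) |a. a < k}"
      using H(2) H'(2) j l by (intro Collect_cong ex_cong1) (auto simp: replace_col_def)
    then show ?thesis using H(2) H'(2) by (simp add: col_degree_def)
  qed
  ultimately have "(\<Sum>l<r. col_degree H l)
      \<le> (\<Sum>l<r. if l = i then col_degree H' j else col_degree H l)"
    using H(2) by (simp add: degree_sum_def replace_col_def)
  then show ?thesis using i
    by (simp add: sum.remove[of "{..<r}" i])
qed

lemma minimal_basis_unique_degrees:
  assumes H: "minimal_basis k S H" and H': "minimal_basis k S H'"
  shows "mset (map (col_degree H) [0..<dim_col H]) = mset (map (col_degree H') [0..<dim_col H'])"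
proof -
  have pH: "poly_basis k S H" "poly_basis k S H'"
    using H H' by (simp_all add: minimal_basis_def)
  obtain r s where c: "H \<in> carrier_mat k r" "H' \<in> carrier_mat k s"
    using pH carrier_matI[OF _ refl] unfolding poly_basis_def by blast
  obtain X where X: "X \<in> carrier_mat r s" "rmat H' = rmat H * X"
    using poly_basis_transition[OF pH(1) c(1) pH(2) c(2)] .
  obtain Y where Y: "Y \<in> carrier_mat s r" "rmat H = rmat H' * Y"
    using poly_basis_transition[OF pH(2) c(2) pH(1) c(1)] .
  have cH: "rmat H \<in> carrier_mat k r" "rmat H' \<in> carrier_mat k s"
    using c by auto
  \<comment> \<open>Going from one basis to the other and back is the identity, so \<open>X\<close>
    and \<open>Y\<close> are mutually inverse and hence square.\<close>
  have "rmat H * (X * Y) = rmat H * 1\<^sub>m r"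
    unfolding assoc_mult_mat[OF cH(1) X(1) Y(1), symmetric] X(2)[symmetric] Y(2)[symmetric]
    using cH by simp
  then have XY: "X * Y = 1\<^sub>m r"
    by (rule poly_basis_cancel[OF pH(1) c(1) mult_carrier_mat[OF X(1) Y(1)] one_carrier_mat])
  have "rmat H' * (Y * X) = rmat H' * 1\<^sub>m s"
    unfolding assoc_mult_mat[OF cH(2) Y(1) X(1), symmetric] X(2)[symmetric] Y(2)[symmetric]
    using cH by simp
  then have YX: "Y * X = 1\<^sub>m s"
    by (rule poly_basis_cancel[OF pH(2) c(2) mult_carrier_mat[OF Y(1) X(1)] one_carrier_mat])
  have r: "s = r"
    using left_inverse_dim_le[OF X(1) Y(1) YX] left_inverse_dim_le[OF Y(1) X(1) XY] by simp
  have Xr: "X \<in> carrier_mat r r" "Y \<in> carrier_mat r r" using X(1) Y(1) r by auto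
  have "det X \<noteq> 0" using det_mult[OF Xr] XY by auto
  \<comment> \<open>a nonvanishing term of the Leibniz expansion matches the columns of \<open>H\<close> and \<open>H'\<close>\<close>
  then obtain \<sigma> where \<sigma>: "\<sigma> permutes {0..<r}" "(\<Prod>i = 0..<r. X $$ (i, \<sigma> i)) \<noteq> 0"
    unfolding det_def'[OF Xr(1)] by (metis (no_types, lifting) sum.neutral mult_zero_right mem_Collect_eq)
  have \<sigma>r: "\<sigma> i < r" if "i < r" for i using permutes_in_image[OF \<sigma>(1), of i] that by auto
  have le: "col_degree H i \<le> col_degree H' (\<sigma> i)" if "i < r" for i
    using \<sigma>(2) that \<sigma>r r by (intro minimal_basis_exchange[OF H c(1) pH(2) c(2) X]) auto
  have "degree_sum H = degree_sum H'"
    using H H' pH unfolding minimal_basis_def by (meson antisym)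
  also have "degree_sum H' = (\<Sum>i\<in>{0..<r}. col_degree H' (\<sigma> i))"
    using sum.permute[OF \<sigma>(1), of "col_degree H'"] c(2)
    by (simp add: degree_sum_def r lessThan_atLeast0 comp_def)
  finally have "(\<Sum>i\<in>{0..<r}. col_degree H i) = (\<Sum>i\<in>{0..<r}. col_degree H' (\<sigma> i))"
    using c(1) by (simp add: degree_sum_def lessThan_atLeast0)
  \<comment> \<open>Two equal sums with termwise inequality agree term by term. Thus the one-sided
    exchange estimate already gives equality of the matched degrees.\<close>
  from sum_mono_inv[OF this] le
  have eq: "col_degree H i = col_degree H' (\<sigma> i)" if "i < r" for i using that by auto
  have "image_mset (col_degree H) (mset_set {0..<r})
      = image_mset (col_degree H') (image_mset \<sigma> (mset_set {0..<r}))"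
    unfolding multiset.map_comp by (rule image_mset_cong) (auto simp: eq)
  also have "image_mset \<sigma> (mset_set {0..<r}) = mset_set {0..<r}"
    using permutes_image[OF \<sigma>(1)] permutes_inj_on[OF \<sigma>(1)] by (subst image_mset_mset_set) auto
  finally show ?thesis using c r by simp
qed

text \<open>Removes the arbitrary choice in \<open>minimal_indices\<close>: once a minimal basis
  exists, \<open>SOME\<close> picks a minimal basis, and any two have the same degrees.\<close>

lemma minimal_indices_eq:
  assumes "minimal_basis k S H"
  shows "minimal_indices k S = mset (map (col_degree H) [0..<dim_col H])"
  unfolding minimal_indices_def Let_def
  by (rule minimal_basis_unique_degrees[OF _ assms]) (rule someI[of "minimal_basis k S", OF assms])

section \<open>Right coprimeness and polynomial solutions\<close>

text \<open>Euclid's algorithm over an arbitrary field; \<open>d\<close> is a greatest common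
  divisor, fixed only up to a unit.\<close>

lemma poly_bezout:
  fixes a b :: "'a::field poly"
  obtains u v d where "d = u * a + v * b" "d dvd a" "d dvd b"
proof -
  have "\<exists>u v d. d = u * a + v * b \<and> d dvd a \<and> d dvd b"
  \<comment> \<open>The measure puts the zero polynomial strictly below the nonzero constants, which
    \<open>degree\<close> alone does not separate.\<close>
  proof (induction "if b = 0 then 0 else Suc (degree b)" arbitrary: a b rule: less_induct)
    case less
    show ?case
    proof (cases "b = 0")
      case True
      then show ?thesis by (intro exI[of _ 1] exI[of _ 0] exI[of _ a]) simp
    next
      case False
      have "(if a mod b = 0 then 0 else Suc (degree (a mod b)))
          < (if b = 0 then 0 else Suc (degree b))"
        using degree_mod_less[OF False, of a] False by auto
      from less[OF this]
      obtain u v d where d: "d = u * b + v * (a mod b)" "d dvd b" "d dvd a mod b" by blast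
      have "d = v * a + (u - v * (a div b)) * b"
        by (simp add: d(1) minus_div_mult_eq_mod[symmetric] algebra_simps)
      moreover have "d dvd a" using d(2,3) by (simp add: dvd_mod_iff)
      ultimately show ?thesis using d(2) by blast
    qed
  qed
  then show thesis using that by blast
qed

text \<open>The right factor is the inverse of the identity matrix with \<open>i\<close>-th column replaced by
  \<open>s / q\<close>; its determinant is \<open>q\<close>.\<close>

lemma right_factor:
  fixes M :: "'b::comm_ring_1 mat"
  assumes M: "M \<in> carrier_mat k n" and s: "s \<in> carrier_vec n" and b: "b \<in> carrier_vec k"
    and eq: "M *\<^sub>v s = q \<cdot>\<^sub>v b" and i: "i < n" "s $ i = 1"
  shows "M = replace_col M b i * replace_col (1\<^sub>m n) (vec n (\<lambda>j. if j = i then q else - s $ j)) i"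
proof -
  define w where "w = vec n (\<lambda>j. if j = i then q else - s $ j)"
  define M' where "M' = replace_col M b i"
  have M': "M' \<in> carrier_mat k n" using M by (simp add: M'_def replace_col_def)
  have w: "w \<in> carrier_vec n" by (simp add: w_def)
  \<comment> \<open>In row \<open>l\<close> the product is \<open>q * b $ l\<close> minus the terms
    \<open>M $$ (l,j) * s $ j\<close> with \<open>j\<close> different from \<open>i\<close>. As
    \<open>q * b\<close> is \<open>M\<close> times \<open>s\<close> and \<open>s $ i = 1\<close>,
    only \<open>M $$ (l,i)\<close> remains.\<close>
  have "M' *\<^sub>v w = col M i"
  proof (rule eq_vecI)
    fix l assume "l < dim_vec (col M i)"
    then have l: "l < k" using M by simp
    have "q * b $ l = (M *\<^sub>v s) $ l" using eq b l by simp
    also have "\<dots> = (\<Sum>j = 0..<n. M $$ (l,j) * s $ j)"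
      using M s l by (simp add: scalar_prod_def)
    also have "\<dots> = M $$ (l,i) + (\<Sum>j \<in> {0..<n} - {i}. M $$ (l,j) * s $ j)"
      using i by (simp add: sum.remove[of "{0..<n}" i])
    finally have qb: "q * b $ l = \<dots>" .
    have "(M' *\<^sub>v w) $ l = (\<Sum>j = 0..<n. M' $$ (l,j) * w $ j)"
      using M' w l by (simp add: scalar_prod_def)
    also have "\<dots> = M' $$ (l,i) * w $ i + (\<Sum>j \<in> {0..<n} - {i}. M' $$ (l,j) * w $ j)"
      using i by (simp add: sum.remove[of "{0..<n}" i])
    also have "M' $$ (l,i) * w $ i = q * b $ l"
      using M l i by (simp add: M'_def w_def replace_col_def mult.commute)
    also have "(\<Sum>j \<in> {0..<n} - {i}. M' $$ (l,j) * w $ j)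
        = - (\<Sum>j \<in> {0..<n} - {i}. M $$ (l,j) * s $ j)"
      unfolding sum_negf[symmetric] using M l
      by (intro sum.cong) (auto simp: M'_def w_def replace_col_def)
    finally show "(M' *\<^sub>v w) $ l = col M i $ l" using qb l i M by simp
  qed (use M M' in simp)
  then have "M' * replace_col (1\<^sub>m n) w i = replace_col M' (col M i) i"
    using mult_replace_col_one[OF M' w i(1)] by simp
  also have "\<dots> = M"
    using M i by (intro eq_matI) (auto simp: M'_def replace_col_def)
  finally show ?thesis by (simp add: M'_def w_def)
qed

lemma mult_mat_smult_vec:
  fixes A :: "'b::comm_ring_1 mat"
  assumes "A \<in> carrier_mat nr nc" "v \<in> carrier_vec nc"
  shows "A *\<^sub>v (k \<cdot>\<^sub>v v) = k \<cdot>\<^sub>v (A *\<^sub>v v)"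
  using assms by (intro eq_vecI) auto

lemma mult_mat_unit_vec:
  fixes A :: "'b::comm_ring_1 mat"
  assumes "A \<in> carrier_mat nr nc" "j < nc"
  shows "A *\<^sub>v unit_vec nc j = col A j"
  using assms by (intro eq_vecI) auto

lemma unimodular_det_dvd_1:
  assumes W: "W \<in> carrier_mat n n" and "unimodular W"
  shows "det W dvd 1"
proof -
  obtain V where V: "W * V = 1\<^sub>m (dim_row W)" "V * W = 1\<^sub>m (dim_row V)"
    using assms(2) unfolding unimodular_def invertible_mat_def inverts_mat_def by blast
  \<comment> \<open>\<open>inverts_mat\<close> leaves the shape of \<open>V\<close> open; comparing
    dimensions in the two identities shows that it is \<open>n\<close> by \<open>n\<close>.\<close>
  have "dim_col V = n" using arg_cong[OF V(1), of dim_col] W by simp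
  moreover have "dim_row V = n" using arg_cong[OF V(2), of dim_col] W by simp
  ultimately have "V \<in> carrier_mat n n" by blast
  then have "det W * det V = 1" using det_mult[OF W, of V] V(1) W by simp
  then show ?thesis by (metis dvd_triv_left)
qed

text \<open>By \<open>right_factor\<close>, one and the same \<open>W\<close> is a right divisor of
  both \<open>A\<close> and \<open>C\<close>, because it depends only on \<open>s\<close>,
  \<open>i\<close> and \<open>q\<close>. Coprimeness makes \<open>W\<close> unimodular, and its
  determinant is \<open>q\<close>.\<close>

lemma right_coprime_unit_content:
  assumes cop: "right_coprime A C"
    and A: "A \<in> carrier_mat k n" and C: "C \<in> carrier_mat p n"
    and s: "s \<in> carrier_vec n" "i < n" "s $ i = 1"
    and a: "a \<in> carrier_vec k" "A *\<^sub>v s = q \<cdot>\<^sub>v a"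
    and c: "c \<in> carrier_vec p" "C *\<^sub>v s = q \<cdot>\<^sub>v c"
  shows "q dvd 1"
proof -
  define w where "w = vec n (\<lambda>j. if j = i then q else - s $ j)"
  define W where "W = replace_col (1\<^sub>m n) w i"
  have W: "W \<in> carrier_mat n n" by (simp add: W_def replace_col_def)
  have "A = replace_col A a i * W" "C = replace_col C c i * W"
    using right_factor[OF A s(1) a s(2,3)] right_factor[OF C s(1) c s(2,3)]
    by (simp_all add: W_def w_def)
  moreover have "replace_col A a i \<in> carrier_mat k n" "replace_col C c i \<in> carrier_mat p n"
    using A C by (auto simp: replace_col_def)
  ultimately have "common_right_divisor A C W"
    unfolding common_right_divisor_def using A C W by auto
  then have "unimodular W" using cop by (simp add: right_coprime_def)
  then have "det W dvd 1" by (rule unimodular_det_dvd_1[OF W])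
  moreover have "det W = q"
    unfolding W_def using s(2) by (subst det_replace_col_one) (auto simp: w_def)
  ultimately show ?thesis by simp
qed

text \<open>By induction on the degree of \<open>q\<close>, \<open>q\<close> may be assumed to be coprime to an entry \<open>g\<^sub>i\<close> which
  it does not divide: a proper common divisor \<open>d\<close> of \<open>q = d e\<close> and \<open>g\<^sub>i\<close> lets \<open>d\<close> and then \<open>e\<close> be
  cancelled. Bezout's identity then turns \<open>g\<close> into a vector with \<open>i\<close>-th entry 1.\<close>

lemma right_coprime_dvd:
  assumes cop: "right_coprime A C"
    and A: "A \<in> carrier_mat k n" and C: "C \<in> carrier_mat p n"
    and "q \<noteq> 0" "g \<in> carrier_vec n"
    and "a \<in> carrier_vec k" "A *\<^sub>v g = q \<cdot>\<^sub>v a"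
    and "c \<in> carrier_vec p" "C *\<^sub>v g = q \<cdot>\<^sub>v c"
  shows "\<exists>h \<in> carrier_vec n. g = q \<cdot>\<^sub>v h"
  using assms(4-)
proof (induction "degree q" arbitrary: q g a c rule: less_induct)
  case less
  note q = less.prems(1) and g = less.prems(2) and a = less.prems(3,4) and c = less.prems(5,6)
  have "q dvd g $ i" if i: "i < n" for i
  proof (rule ccontr)
    assume nd: "\<not> q dvd g $ i"
    obtain u v d where d: "d = u * g $ i + v * q" "d dvd g $ i" "d dvd q"
      using poly_bezout .
    from d(3) obtain e where e: "q = d * e" by (elim dvdE)
    have de: "d \<noteq> 0" "e \<noteq> 0" using q e by auto
    have deg: "degree q = degree d + degree e" using de e by (simp add: degree_mult_eq)
    show False
    proof (cases "degree d = 0 \<or> degree e = 0")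
      case False
      have "\<exists>h \<in> carrier_vec n. g = d \<cdot>\<^sub>v h"
        using False deg de g a c
        by (intro less.hyps[of d g "e \<cdot>\<^sub>v a" "e \<cdot>\<^sub>v c"]) (auto simp: e smult_smult_assoc)
      then obtain h where h: "h \<in> carrier_vec n" "g = d \<cdot>\<^sub>v h" by blast
      have "d \<cdot>\<^sub>v (A *\<^sub>v h) = d \<cdot>\<^sub>v (e \<cdot>\<^sub>v a)" "d \<cdot>\<^sub>v (C *\<^sub>v h) = d \<cdot>\<^sub>v (e \<cdot>\<^sub>v c)"
        using a(2) c(2) unfolding h(2) mult_mat_smult_vec[OF A h(1)] mult_mat_smult_vec[OF C h(1)]
        by (simp_all add: e smult_smult_assoc)
      then have "A *\<^sub>v h = e \<cdot>\<^sub>v a" "C *\<^sub>v h = e \<cdot>\<^sub>v c"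
        using de(1) by (auto simp: vec_eq_iff)
      then have "\<exists>h' \<in> carrier_vec n. h = e \<cdot>\<^sub>v h'"
        using False deg de h a c by (intro less.hyps[of e h a c]) auto
      then obtain h' where "h' \<in> carrier_vec n" "g = q \<cdot>\<^sub>v h'"
        using h(2) by (auto simp: e smult_smult_assoc)
      then show False using nd i by auto
    next
      case True
      then show False
      proof
        assume "degree e = 0"
        then have "e dvd 1" using de(2) by (simp add: is_unit_iff_degree)
        then have "q dvd d" unfolding e by (simp add: mult_unit_dvd_iff)
        then show False using d(2) nd dvd_trans by blast
      next
        assume "degree d = 0"
        then have "d dvd 1" using de(1) by (simp add: is_unit_iff_degree)
        then obtain t where "1 = d * t" by (elim dvdE)
        then have one: "1 = t * u * g $ i + t * v * q"
          by (simp add: d(1) algebra_simps)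
        \<comment> \<open>Modulo \<open>q\<close> the vector \<open>s\<close> is a multiple of
          \<open>g\<close>, so \<open>A\<close> and \<open>C\<close> still send it to multiples of
          \<open>q\<close>; the identity \<open>one\<close> makes its entry \<open>i\<close> equal
          to 1.\<close>
        define s where "s = (t * u) \<cdot>\<^sub>v g + (t * v * q) \<cdot>\<^sub>v unit_vec n i"
        have s: "s \<in> carrier_vec n" "s $ i = 1" using g i one by (simp_all add: s_def)
        have s_mult: "M *\<^sub>v s = q \<cdot>\<^sub>v ((t * u) \<cdot>\<^sub>v b + (t * v) \<cdot>\<^sub>v col M i)"
          if M: "M \<in> carrier_mat l n" and b: "b \<in> carrier_vec l" "M *\<^sub>v g = q \<cdot>\<^sub>v b" for M b l
        proof -
          have "M *\<^sub>v s = (t * u) \<cdot>\<^sub>v (M *\<^sub>v g) + (t * v * q) \<cdot>\<^sub>v (M *\<^sub>v unit_vec n i)"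
            unfolding s_def using M g
            by (simp add: mult_add_distrib_mat_vec[OF M] mult_mat_smult_vec[OF M])
          also have "M *\<^sub>v unit_vec n i = col M i" using mult_mat_unit_vec[OF M i] .
          also have "M *\<^sub>v g = q \<cdot>\<^sub>v b" by (rule b)
          finally show ?thesis
            using M b(1) i by (auto simp: vec_eq_iff algebra_simps)
        qed
        have "q dvd 1"
          using a c A C i s
          by (intro right_coprime_unit_content[OF cop A C s(1) i s(2) _ s_mult[OF A a] _ s_mult[OF C c]]) auto
        then show False using nd dvd_trans one_dvd by blast
      qed
    qed
  qed
  then have "\<forall>i. \<exists>x. i < n \<longrightarrow> g $ i = q * x" by (auto elim: dvdE)
  then obtain h where "\<And>i. i < n \<Longrightarrow> g $ i = q * h i" by metis
  then show ?case using g by (intro bexI[of _ "vec n h"]) auto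
qed

text \<open>The adjugate supplies a common denominator: multiplying
  \<open>rmat A *\<^sub>v x\<close> by it gives \<open>det A\<close> times \<open>x\<close>, which
  is therefore a polynomial vector \<open>g\<close>. Then \<open>right_coprime_dvd\<close> with
  \<open>q = det A\<close> divides the factor out again.\<close>

lemma right_coprime_polynomial_vec:
  assumes cop: "right_coprime A C"
    and A: "A \<in> carrier_mat n n" "det A \<noteq> 0" and C: "C \<in> carrier_mat p n"
    and x: "x \<in> carrier_vec n"
    and a: "a \<in> carrier_vec n" "rmat A *\<^sub>v x = map_vec rat_of_poly a"
    and c: "c \<in> carrier_vec p" "rmat C *\<^sub>v x = map_vec rat_of_poly c"
  shows "\<exists>h \<in> carrier_vec n. x = map_vec rat_of_poly h"
proof -
  note adj = adj_mat[OF A(1)]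
  define g where "g = adj_mat A *\<^sub>v a"
  have g: "g \<in> carrier_vec n" using adj(1) a by (simp add: g_def)
  have rA: "rmat A \<in> carrier_mat n n" "rmat C \<in> carrier_mat p n" "rmat (adj_mat A) \<in> carrier_mat n n"
    using A C adj by simp_all
  have "map_vec rat_of_poly g = rmat (adj_mat A) *\<^sub>v (rmat A *\<^sub>v x)"
    unfolding g_def a(2) by (rule rmat_mult_vec[OF adj(1) a(1)])
  also have "\<dots> = rmat (adj_mat A * A) *\<^sub>v x"
    using rmat_mult[OF adj(1) A(1)] assoc_mult_mat_vec[OF rA(3,1) x] by simp
  also have "rmat (adj_mat A * A) = rat_of_poly (det A) \<cdot>\<^sub>m 1\<^sub>m n"
    unfolding adj(3) by (rule eq_matI) (auto simp: rmat_def)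
  also have "\<dots> *\<^sub>v x = rat_of_poly (det A) \<cdot>\<^sub>v (1\<^sub>m n *\<^sub>v x)"
    using x by auto
  finally have gx: "map_vec rat_of_poly g = rat_of_poly (det A) \<cdot>\<^sub>v x"
    using x by simp
  have "A *\<^sub>v g = (A * adj_mat A) *\<^sub>v a"
    unfolding g_def using assoc_mult_mat_vec[OF A(1) adj(1) a(1)] by simp
  then have Ag: "A *\<^sub>v g = det A \<cdot>\<^sub>v a" unfolding adj(2) using a by auto
  have "map_vec rat_of_poly (C *\<^sub>v g) = map_vec rat_of_poly (det A \<cdot>\<^sub>v c)"
    using rmat_mult_vec[OF C g] mult_mat_smult_vec[OF rA(2) x] c
    by (simp add: gx rat_of_poly.vec_hom_smult)
  then have Cg: "C *\<^sub>v g = det A \<cdot>\<^sub>v c" by (simp add: rat_of_poly.vec_hom_inj)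
  obtain h where h: "h \<in> carrier_vec n" "g = det A \<cdot>\<^sub>v h"
    using right_coprime_dvd[OF cop A(1) C A(2) g a(1) Ag c(1) Cg] by blast
  have "rat_of_poly (det A) \<cdot>\<^sub>v x = rat_of_poly (det A) \<cdot>\<^sub>v map_vec rat_of_poly h"
    using gx h by (simp add: rat_of_poly.vec_hom_smult)
  then have "x = map_vec rat_of_poly h"
    using A(2) by (auto simp: vec_eq_iff)
  then show ?thesis using h by blast
qed

lemma right_coprime_polynomial_mat:
  assumes cop: "right_coprime A C"
    and A: "A \<in> carrier_mat n n" "det A \<noteq> 0" and C: "C \<in> carrier_mat p n"
    and X: "X \<in> carrier_mat n r"
    and a: "M \<in> carrier_mat n r" "rmat A * X = rmat M"
    and c: "N \<in> carrier_mat p r" "rmat C * X = rmat N"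
  shows "\<exists>H \<in> carrier_mat n r. X = rmat H"
proof -
  have rA: "rmat A \<in> carrier_mat n n" "rmat C \<in> carrier_mat p n" using A C by auto
  have "\<exists>h. h \<in> carrier_vec n \<and> col X j = map_vec rat_of_poly h" if j: "j < r" for j
    using right_coprime_polynomial_vec[OF cop A C, of "col X j" "col M j" "col N j"]
      col_mult2[OF rA(1) X j, unfolded a(2)] col_mult2[OF rA(2) X j, unfolded c(2)] X a(1) c(1) j
    by auto
  then obtain h where h: "\<And>j. j < r \<Longrightarrow> h j \<in> carrier_vec n"
      "\<And>j. j < r \<Longrightarrow> col X j = map_vec rat_of_poly (h j)" by metis
  define H where "H = mat n r (\<lambda>(i,j). h j $ i)"
  have "X = rmat H"
  proof (rule eq_matI)
    fix i j assume ij: "i < dim_row (rmat H)" "j < dim_col (rmat H)"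
    then have "X $$ (i, j) = col X j $ i" using X by (simp add: H_def)
    then show "X $$ (i, j) = rmat H $$ (i, j)"
      using h(1)[of j] h(2)[of j] ij by (simp add: H_def rmat_def)
  qed (use X in \<open>auto simp: H_def\<close>)
  then show ?thesis by (intro bexI[of _ H]) (auto simp: H_def)
qed

section \<open>Inverse matrices\<close>

lemma inv_mat:
  fixes A :: "'b::field mat"
  assumes A: "A \<in> carrier_mat n n" and "det A \<noteq> 0"
  shows "inv_mat A \<in> carrier_mat n n" "A * inv_mat A = 1\<^sub>m n" "inv_mat A * A = 1\<^sub>m n"
proof -
  have "\<exists>B. B \<in> carrier_mat (dim_row A) (dim_row A) \<and>
      A * B = 1\<^sub>m (dim_row A) \<and> B * A = 1\<^sub>m (dim_row A)"
    using det_nonzero_inverse[OF assms] A by auto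
  from someI_ex[OF this] A
  show "inv_mat A \<in> carrier_mat n n" "A * inv_mat A = 1\<^sub>m n" "inv_mat A * A = 1\<^sub>m n"
    unfolding inv_mat_def by auto
qed

lemma inv_mat_unique:
  fixes A :: "'b::field mat"
  assumes A: "A \<in> carrier_mat n n" and B: "B \<in> carrier_mat n n" and AB: "A * B = 1\<^sub>m n"
  shows "inv_mat A = B"
proof -
  have "det A \<noteq> 0" using det_mult[OF A B] AB by auto
  note inv = inv_mat[OF A this]
  have "inv_mat A * (A * B) = B"
    using assoc_mult_mat[OF inv(1) A B] inv(3) B by simp
  then show ?thesis using AB inv(1) by simp
qed

lemma inv_mat_transpose:
  fixes A :: "'b::field mat"
  assumes A: "A \<in> carrier_mat n n" and "det A \<noteq> 0"
  shows "inv_mat (transpose_mat A) = transpose_mat (inv_mat A)"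
proof (rule inv_mat_unique)
  note inv = inv_mat[OF assms]
  show "transpose_mat A * transpose_mat (inv_mat A) = 1\<^sub>m n"
    unfolding transpose_mult[OF inv(1) A, symmetric] inv(3) by simp
qed (use inv_mat(1)[OF assms] A in auto)

section \<open>Degrees of rational functions and of lifted columns\<close>

text \<open>The rational functions of degree at most \<open>d\<close>; the proper ones are those with \<open>d = 0\<close>.\<close>

definition rat_degree_le :: "nat \<Rightarrow> 'a::field poly fract \<Rightarrow> bool" where
  "rat_degree_le d r \<longleftrightarrow> (\<exists>p q. q \<noteq> 0 \<and> r = Fract p q \<and> degree p \<le> degree q + d)"

text \<open>If \<open>p\<close> equals the fraction \<open>a / b\<close>, then
  \<open>p * b = a\<close> and degrees add. So on polynomials the bound is the ordinary one,
  whichever fraction witnesses it.\<close>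

lemma rat_degree_le_rat_of_poly: "rat_degree_le d (rat_of_poly p) \<longleftrightarrow> degree p \<le> d"
proof
  assume "rat_degree_le d (rat_of_poly p)"
  then obtain a b where ab: "b \<noteq> 0" "rat_of_poly p = Fract a b" "degree a \<le> degree b + d"
    unfolding rat_degree_le_def by blast
  then have "p * b = a" by (simp add: rat_of_poly_def eq_fract)
  then show "degree p \<le> d" using ab by (cases "p = 0") (auto simp: degree_mult_eq)
next
  assume "degree p \<le> d"
  then show "rat_degree_le d (rat_of_poly p)"
    unfolding rat_degree_le_def rat_of_poly_def by (intro exI[of _ p] exI[of _ 1]) auto
qed

lemma rat_degree_le_add:
  assumes "rat_degree_le d x" "rat_degree_le d y"
  shows "rat_degree_le d (x + y)"
proof -
  obtain a b a' b' where ab: "b \<noteq> 0" "x = Fract a b" "degree a \<le> degree b + d"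
    "b' \<noteq> 0" "y = Fract a' b'" "degree a' \<le> degree b' + d"
    using assms unfolding rat_degree_le_def by blast
  have "degree (a * b' + a' * b) \<le> degree (b * b') + d"
    using ab degree_mult_le[of a b'] degree_mult_le[of a' b]
    by (intro degree_add_le) (auto simp: degree_mult_eq)
  then show ?thesis using ab unfolding rat_degree_le_def
    by (intro exI[of _ "a * b' + a' * b"] exI[of _ "b * b'"]) simp
qed

lemma rat_degree_le_sum:
  "(\<And>i. i \<in> I \<Longrightarrow> rat_degree_le d (f i)) \<Longrightarrow> rat_degree_le d (sum f I)"
  by (induction I rule: infinite_finite_induct)
    (auto simp: rat_degree_le_add rat_degree_le_rat_of_poly[of d 0, simplified])

lemma rat_degree_le_mult:
  assumes "proper_rat x" "rat_degree_le d y"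
  shows "rat_degree_le d (x * y)"
proof -
  obtain a b a' b' where ab: "b \<noteq> 0" "x = Fract a b" "degree a \<le> degree b"
    "b' \<noteq> 0" "y = Fract a' b'" "degree a' \<le> degree b' + d"
    using assms unfolding rat_degree_le_def proper_rat_def by blast
  have "degree (a * a') \<le> degree (b * b') + d"
    using ab degree_mult_le[of a a'] by (auto simp: degree_mult_eq)
  then show ?thesis using ab unfolding rat_degree_le_def
    by (intro exI[of _ "a * a'"] exI[of _ "b * b'"]) simp
qed

text \<open>The \<open>insert 0\<close> in \<open>col_degree\<close> makes \<open>Max\<close>
  defined also for a matrix without rows, so the criterion covers \<open>k = 0\<close>.\<close>

lemma col_degree_le_iff:
  "H \<in> carrier_mat k r \<Longrightarrow> col_degree H j \<le> d \<longleftrightarrow> (\<forall>i<k. degree (H $$ (i, j)) \<le> d)"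
  unfolding col_degree_def by (subst Max_le_iff) auto

text \<open>Each entry of the upper block is, up to sign, a combination of entries of the same
  column of \<open>H2\<close> with proper coefficients, so its degree cannot exceed the degree of
  that column. The reverse inequality holds because \<open>H2\<close> is itself a block of the
  stacked matrix.\<close>

lemma col_degree_proper_lift:
  assumes K: "K \<in> carrier_mat n m" "proper_mat K"
    and H1: "H1 \<in> carrier_mat n r" and H2: "H2 \<in> carrier_mat m r"
    and eq: "rmat H1 = - (K * rmat H2)" and j: "j < r"
  shows "col_degree (H1 @\<^sub>r H2) j = col_degree H2 j"
proof (rule antisym)
  have ar: "H1 @\<^sub>r H2 \<in> carrier_mat (n + m) r" using H1 H2 by simp
  have entry: "(H1 @\<^sub>r H2) $$ (i, j) = (if i < n then H1 $$ (i, j) else H2 $$ (i - n, j))"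
    if "i < n + m" for i
    using H1 H2 j that by (simp add: append_rows_def)
  have "degree (H2 $$ (i, j)) \<le> col_degree H2 j" if "i < m" for i
    using col_degree_le_iff[OF H2, of j "col_degree H2 j"] that by simp
  note H2_le = this
  have "degree (H1 $$ (i, j)) \<le> col_degree H2 j" if i: "i < n" for i
  proof -
    have "rat_of_poly (- H1 $$ (i, j)) = (K * rmat H2) $$ (i, j)"
      using arg_cong[OF eq, of "\<lambda>M. M $$ (i, j)"] K(1) H1 H2 i j
      by (simp add: rmat_def rat_of_poly.hom_uminus)
    also have "\<dots> = (\<Sum>l = 0..<m. K $$ (i, l) * rat_of_poly (H2 $$ (l, j)))"
      using K(1) H2 i j by (simp add: scalar_prod_def rmat_def)
    finally have "rat_degree_le (col_degree H2 j) (rat_of_poly (- H1 $$ (i, j)))"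
      using K i H2_le
      by (auto intro!: rat_degree_le_sum rat_degree_le_mult
          simp: rat_degree_le_rat_of_poly proper_mat_def)
    then show ?thesis by (simp add: rat_degree_le_rat_of_poly)
  qed
  then show "col_degree (H1 @\<^sub>r H2) j \<le> col_degree H2 j"
    using H2_le by (auto simp: col_degree_le_iff[OF ar] entry)
  have "\<forall>i<n + m. degree ((H1 @\<^sub>r H2) $$ (i, j)) \<le> col_degree (H1 @\<^sub>r H2) j"
    using col_degree_le_iff[OF ar, of j "col_degree (H1 @\<^sub>r H2) j"] by simp
  then have "degree ((H1 @\<^sub>r H2) $$ (n + i, j)) \<le> col_degree (H1 @\<^sub>r H2) j" if "i < m" for i
    using that by simp
  then show "col_degree H2 j \<le> col_degree (H1 @\<^sub>r H2) j"
    unfolding col_degree_le_iff[OF H2] by (auto simp: entry)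
qed

section \<open>Stacked matrices and signs\<close>

lemma append_rows_rmat:
  "H1 \<in> carrier_mat n r \<Longrightarrow> H2 \<in> carrier_mat m r \<Longrightarrow> rmat (H1 @\<^sub>r H2) = rmat H1 @\<^sub>r rmat H2"
  by (rule eq_matI) (auto simp: append_rows_def rmat_def)

lemma append_rows_split:
  assumes "H \<in> carrier_mat (n + m) r"
  obtains H1 H2 where "H1 \<in> carrier_mat n r" "H2 \<in> carrier_mat m r" "H = H1 @\<^sub>r H2"
proof
  show "mat n r (\<lambda>(i, j). H $$ (i, j)) \<in> carrier_mat n r"
    "mat m r (\<lambda>(i, j). H $$ (n + i, j)) \<in> carrier_mat m r" by auto
  show "H = mat n r (\<lambda>(i, j). H $$ (i, j)) @\<^sub>r mat m r (\<lambda>(i, j). H $$ (n + i, j))"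
    using assms by (intro eq_matI) (auto simp: append_rows_def)
qed

lemma add_eq_zero_vec_iff:
  fixes v w :: "'b::ab_group_add vec"
  assumes "v \<in> carrier_vec n" "w \<in> carrier_vec n"
  shows "v + w = 0\<^sub>v n \<longleftrightarrow> v = - w"
  using assms by (auto simp: vec_eq_iff eq_neg_iff_add_eq_0)

lemma mult_uminus_right_mat:
  fixes X Y :: "'b::ring mat"
  assumes "X \<in> carrier_mat k n" "Y \<in> carrier_mat n l"
  shows "X * (- Y) = - (X * Y)"
  using assms by (intro uminus_mult_right_mat) simp

lemma mult_uminus_left_mat:
  fixes X Y :: "'b::ring mat"
  assumes "X \<in> carrier_mat k n" "Y \<in> carrier_mat n l"
  shows "(- X) * Y = - (X * Y)"
  using assms by (intro uminus_mult_left_mat) simp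

section \<open>Null spaces and minimal bases of \<open>G\<close> and of its system matrix\<close>

text \<open>Collects the hypotheses of the right-hand statement, so that the left-hand one arises by
  interpreting the locale for the transposed data.\<close>

locale coprime_system =
  fixes G :: "'a::field poly fract mat" and A B C D :: "'a poly mat" and n m p :: nat
  assumes sys: "is_system_matrix_of G A B C D n m p"
    and coprime: "right_coprime A C"
    and proper: "proper_mat (inv_mat (rmat A) * rmat B)"
begin

definition "K = inv_mat (rmat A) * rmat B"
definition "P = rmat (system_matrix A B C D)"

lemma carriers:
  "A \<in> carrier_mat n n" "B \<in> carrier_mat n m" "C \<in> carrier_mat p n" "D \<in> carrier_mat p m"
  and det_A: "det A \<noteq> 0" and G_eq: "G = rmat D + rmat C * inv_mat (rmat A) * rmat B"
  using sys by (auto simp: is_system_matrix_of_def regular_pmat_def)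

lemma rcarriers:
  "rmat A \<in> carrier_mat n n" "rmat B \<in> carrier_mat n m"
  "rmat C \<in> carrier_mat p n" "rmat D \<in> carrier_mat p m"
  using carriers by auto

lemma inv_A:
  "inv_mat (rmat A) \<in> carrier_mat n n" "rmat A * inv_mat (rmat A) = 1\<^sub>m n"
  "inv_mat (rmat A) * rmat A = 1\<^sub>m n"
  using inv_mat[OF rcarriers(1)] det_A by (auto simp: rmat_def)

lemma K: "K \<in> carrier_mat n m" and A_K: "rmat A * K = rmat B"
  using mult_carrier_mat[OF inv_A(1) rcarriers(2)] rcarriers(2)
    assoc_mult_mat[OF rcarriers(1) inv_A(1) rcarriers(2)] inv_A(2)
  by (auto simp: K_def)

lemma G_K: "G = rmat D + rmat C * K"
  unfolding G_eq K_def assoc_mult_mat[OF rcarriers(3) inv_A(1) rcarriers(2)] ..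

lemma G: "G \<in> carrier_mat p m"
  unfolding G_K using K rcarriers by auto

lemma P_carrier: "P \<in> carrier_mat (n + p) (n + m)"
  using carriers by (simp add: P_def system_matrix_def)

lemma P: "P = four_block_mat (rmat A) (rmat B) (- rmat C) (rmat D)"
  using carriers unfolding P_def system_matrix_def rmat_uminus[symmetric] unfolding rmat_def
  by (intro map_four_block_mat) auto

text \<open>Since \<open>A\<close> is invertible over the rational functions, the first block row
  can be solved uniquely for \<open>x1\<close>. Substituting the solution into the second block row
  leaves \<open>G *\<^sub>v x2\<close>.\<close>

lemma null_iff:
  assumes x1: "x1 \<in> carrier_vec n" and x2: "x2 \<in> carrier_vec m"
  shows "x1 @\<^sub>v x2 \<in> right_null P \<longleftrightarrow> x1 = - (K *\<^sub>v x2) \<and> x2 \<in> right_null G"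
proof -
  note r = rcarriers
  have AK: "rmat A *\<^sub>v (K *\<^sub>v x2) = rmat B *\<^sub>v x2"
    using assoc_mult_mat_vec[OF r(1) K x2] A_K by simp
  have Kx: "K *\<^sub>v x2 \<in> carrier_vec n" using K x2 by auto
  have "rmat A *\<^sub>v x1 + rmat B *\<^sub>v x2 = 0\<^sub>v n \<longleftrightarrow> x1 = - (K *\<^sub>v x2)"
  proof
    assume "rmat A *\<^sub>v x1 + rmat B *\<^sub>v x2 = 0\<^sub>v n"
    then have 0: "rmat A *\<^sub>v (x1 + K *\<^sub>v x2) = 0\<^sub>v n"
      using mult_add_distrib_mat_vec[OF r(1) x1 Kx] AK by simp
    have "x1 + K *\<^sub>v x2 = inv_mat (rmat A) *\<^sub>v (rmat A *\<^sub>v (x1 + K *\<^sub>v x2))"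
      using assoc_mult_mat_vec[OF inv_A(1) r(1), of "x1 + K *\<^sub>v x2"] inv_A(3) x1 Kx by simp
    also have "\<dots> = 0\<^sub>v n" unfolding 0 using inv_A(1) by auto
    finally show "x1 = - (K *\<^sub>v x2)" using add_eq_zero_vec_iff[OF x1 Kx] by simp
  next
    assume "x1 = - (K *\<^sub>v x2)"
    then have "x1 + K *\<^sub>v x2 = 0\<^sub>v n" using add_eq_zero_vec_iff[OF x1 Kx] by simp
    then have "rmat A *\<^sub>v x1 + rmat B *\<^sub>v x2 = rmat A *\<^sub>v 0\<^sub>v n"
      using mult_add_distrib_mat_vec[OF r(1) x1 Kx] AK by simp
    also have "\<dots> = 0\<^sub>v n" using r(1) by auto
    finally show "rmat A *\<^sub>v x1 + rmat B *\<^sub>v x2 = 0\<^sub>v n" .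
  qed
  moreover have "(- rmat C) *\<^sub>v x1 + rmat D *\<^sub>v x2 = G *\<^sub>v x2" if "x1 = - (K *\<^sub>v x2)"
  proof -
    have "x1 = (- K) *\<^sub>v x2" using that K x2 by simp
    then have "(- rmat C) *\<^sub>v x1 = ((- rmat C) * (- K)) *\<^sub>v x2"
      using assoc_mult_mat_vec[of "- rmat C" p n "- K" m x2] r(3) K x2 by simp
    also have "(- rmat C) * (- K) = rmat C * K"
      using mult_uminus_left_mat[OF r(3), of "- K" m] mult_uminus_right_mat[OF r(3) K] K by simp
    finally show ?thesis
      unfolding G_K using add_mult_distrib_mat_vec[OF r(4) mult_carrier_mat[OF r(3) K] x2]
        r K x2 comm_add_vec[of "rmat D *\<^sub>v x2" p] by auto
  qed
  moreover have "P *\<^sub>v (x1 @\<^sub>v x2)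
      = (rmat A *\<^sub>v x1 + rmat B *\<^sub>v x2) @\<^sub>v ((- rmat C) *\<^sub>v x1 + rmat D *\<^sub>v x2)"
    unfolding P using r x1 x2 by (intro four_block_mat_mult_vec) auto
  moreover have "0\<^sub>v (n + p) = (0\<^sub>v n @\<^sub>v 0\<^sub>v p :: 'a poly fract vec)"
    by (intro eq_vecI) auto
  moreover have "rmat A *\<^sub>v x1 + rmat B *\<^sub>v x2 \<in> carrier_vec n"
    using r x1 x2 by simp
  ultimately have "P *\<^sub>v (x1 @\<^sub>v x2) = 0\<^sub>v (n + p) \<longleftrightarrow> x1 = - (K *\<^sub>v x2) \<and> G *\<^sub>v x2 = 0\<^sub>v p"
    using append_vec_eq[of "rmat A *\<^sub>v x1 + rmat B *\<^sub>v x2" n "0\<^sub>v n"] by auto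
  then show ?thesis
    unfolding right_null_def using P_carrier G x1 x2 by auto
qed

text \<open>The setting of a lifted matrix. That the upper block is polynomial is assumed here;
  \<open>poly_basis_lift\<close> and \<open>poly_basis_drop\<close> supply it.\<close>

context
  fixes H H1 H2 :: "'a poly mat" and r :: nat
  assumes H1: "H1 \<in> carrier_mat n r" and H2: "H2 \<in> carrier_mat m r" and H: "H = H1 @\<^sub>r H2"
    and lift: "rmat H1 = - (K * rmat H2)"
begin

lemma lift_mult_vec:
  assumes x: "x \<in> carrier_vec r"
  shows "rmat H *\<^sub>v x = (- (K *\<^sub>v (rmat H2 *\<^sub>v x))) @\<^sub>v (rmat H2 *\<^sub>v x)"
proof -
  have c: "rmat H1 \<in> carrier_mat n r" "rmat H2 \<in> carrier_mat m r" using H1 H2 by auto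
  have "rmat H *\<^sub>v x = (rmat H1 *\<^sub>v x) @\<^sub>v (rmat H2 *\<^sub>v x)"
    unfolding H append_rows_rmat[OF H1 H2] by (rule mat_mult_append[OF c x])
  also have "rmat H1 *\<^sub>v x = - (K * rmat H2 *\<^sub>v x)"
    unfolding lift using H2 x by (intro uminus_mult_mat_vec) auto
  also have "K * rmat H2 *\<^sub>v x = K *\<^sub>v (rmat H2 *\<^sub>v x)"
    by (rule assoc_mult_mat_vec[OF K c(2) x])
  finally show ?thesis .
qed

text \<open>By \<open>lift_mult_vec\<close> the same coordinate vector \<open>x\<close> describes a
  vector and its lift. Hence membership, independence and spanning transfer one by one along the
  isomorphism of null spaces.\<close>

lemma poly_basis_lift_iff:
  "poly_basis (n + m) (right_null P) H \<longleftrightarrow> poly_basis m (right_null G) H2"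
proof -
  have Hc: "H \<in> carrier_mat (n + m) r" using H1 H2 H by simp
  have rc: "rmat H \<in> carrier_mat (n + m) r" "rmat H2 \<in> carrier_mat m r" using Hc H2 by auto
  have f: "rmat H2 *\<^sub>v x \<in> carrier_vec m" "K *\<^sub>v (rmat H2 *\<^sub>v x) \<in> carrier_vec n"
    if "x \<in> carrier_vec r" for x
    using rc(2) K that by auto
  have mem: "rmat H *\<^sub>v x \<in> right_null P \<longleftrightarrow> rmat H2 *\<^sub>v x \<in> right_null G"
    if "x \<in> carrier_vec r" for x
    unfolding lift_mult_vec[OF that] using f[OF that] by (subst null_iff) auto
  have "col (rmat H) j \<in> right_null P \<longleftrightarrow> col (rmat H2) j \<in> right_null G" if "j < r" for j
    using mem[OF unit_vec_carrier, of j]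
    unfolding mult_mat_unit_vec[OF rc(1) that] mult_mat_unit_vec[OF rc(2) that] .
  then have "(\<forall>j<r. col (rmat H) j \<in> right_null P) \<longleftrightarrow> (\<forall>j<r. col (rmat H2) j \<in> right_null G)"
    by blast
  moreover have "rmat H *\<^sub>v x = 0\<^sub>v (n + m) \<longleftrightarrow> rmat H2 *\<^sub>v x = 0\<^sub>v m"
    if x: "x \<in> carrier_vec r" for x
  proof -
    have "0\<^sub>v (n + m) = (0\<^sub>v n @\<^sub>v 0\<^sub>v m :: 'a poly fract vec)" by (intro eq_vecI) auto
    moreover have "K *\<^sub>v 0\<^sub>v m = 0\<^sub>v n" using K by auto
    ultimately show ?thesis
      using f[OF x] append_vec_eq[of "- (K *\<^sub>v (rmat H2 *\<^sub>v x))" n "0\<^sub>v n"]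
      by (auto simp: lift_mult_vec[OF x])
  qed
  moreover have "(\<forall>v \<in> right_null P. \<exists>x \<in> carrier_vec r. v = rmat H *\<^sub>v x)
      \<longleftrightarrow> (\<forall>w \<in> right_null G. \<exists>x \<in> carrier_vec r. w = rmat H2 *\<^sub>v x)"
  proof (intro iffI ballI)
    fix w assume P: "\<forall>v \<in> right_null P. \<exists>x \<in> carrier_vec r. v = rmat H *\<^sub>v x"
      and w: "w \<in> right_null G"
    have wc: "w \<in> carrier_vec m" using w G by (auto simp: right_null_def)
    have Kw: "- (K *\<^sub>v w) \<in> carrier_vec n" using K wc by auto
    then have "- (K *\<^sub>v w) @\<^sub>v w \<in> right_null P" using null_iff[OF Kw wc] w by simp
    then obtain x where x: "x \<in> carrier_vec r" "- (K *\<^sub>v w) @\<^sub>v w = rmat H *\<^sub>v x"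
      using P by blast
    then have "w = rmat H2 *\<^sub>v x"
      unfolding lift_mult_vec[OF x(1)]
      using append_vec_eq[OF Kw, of "- (K *\<^sub>v (rmat H2 *\<^sub>v x))"] f[OF x(1)] by simp
    then show "\<exists>x \<in> carrier_vec r. w = rmat H2 *\<^sub>v x" using x(1) by blast
  next
    fix v assume G: "\<forall>w \<in> right_null G. \<exists>x \<in> carrier_vec r. w = rmat H2 *\<^sub>v x"
      and v: "v \<in> right_null P"
    then have "v \<in> carrier_vec (n + m)" using P_carrier by (auto simp: right_null_def)
    \<comment> \<open>The lower part of \<open>v\<close> has coordinates with respect to
      \<open>H2\<close>, and \<open>null_iff\<close> determines the upper part, so the same
      coordinates represent \<open>v\<close>.\<close>
    then have split: "vec_first v n @\<^sub>v vec_last v m = v" by simp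
    then have "vec_first v n = - (K *\<^sub>v vec_last v m)" "vec_last v m \<in> right_null G"
      using v null_iff[of "vec_first v n" "vec_last v m"] by auto
    then show "\<exists>x \<in> carrier_vec r. v = rmat H *\<^sub>v x"
      using G split lift_mult_vec by metis
  qed
  moreover have "dim_row H = n + m" "dim_col H = r" "dim_row H2 = m" "dim_col H2 = r"
    using Hc H2 by auto
  ultimately show ?thesis unfolding poly_basis_def by simp
qed

lemma col_degree_lift: "j < r \<Longrightarrow> col_degree H j = col_degree H2 j"
  unfolding H by (rule col_degree_proper_lift[OF K proper[folded K_def] H1 H2 lift])

lemma degree_sum_lift: "degree_sum H = degree_sum H2"
proof -
  have "H \<in> carrier_mat (n + m) r" using H H1 H2 by simp
  then show ?thesis
    unfolding degree_sum_def using col_degree_lift H2 by (auto intro!: sum.cong)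
qed

end

text \<open>Coprimeness enters here: \<open>A\<close> and \<open>C\<close> both map the rational
  matrix \<open>- (K * rmat H2)\<close> to polynomial matrices, so it is polynomial itself.\<close>

lemma poly_basis_lift:
  assumes pb: "poly_basis m (right_null G) H2" and H2: "H2 \<in> carrier_mat m r"
  obtains H1 where "H1 \<in> carrier_mat n r" "rmat H1 = - (K * rmat H2)"
proof -
  have rH2: "rmat H2 \<in> carrier_mat m r" using H2 by simp
  have KH: "K * rmat H2 \<in> carrier_mat n r" using K rH2 by simp
  have "rmat A * (- (K * rmat H2)) = - (rmat A * K * rmat H2)"
    using assoc_mult_mat[OF rcarriers(1) K rH2] mult_uminus_right_mat[OF rcarriers(1) KH] by simp
  also have "\<dots> = rmat (- (B * H2))"
    unfolding A_K rmat_uminus rmat_mult[OF carriers(2) H2] ..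
  finally have AX: "rmat A * (- (K * rmat H2)) = rmat (- (B * H2))" .
  \<comment> \<open>For a column \<open>h\<close> of \<open>H2\<close>, the equation
    \<open>G h = 0\<close> with \<open>G = D + C K\<close> turns \<open>- C K h\<close> into the
    polynomial vector \<open>D h\<close>.\<close>
  have "rmat C * (- (K * rmat H2)) = rmat (D * H2)"
  proof (rule mat_col_eqI)
    fix j assume "j < dim_col (rmat (D * H2))"
    then have j: "j < r" using H2 by simp
    have hc: "col (rmat H2) j \<in> carrier_vec m" using rH2 j by auto
    have "col (rmat H2) j \<in> right_null G" using pb H2 j by (auto simp: poly_basis_def)
    then have "0\<^sub>v p = G *\<^sub>v col (rmat H2) j"
      using G by (simp add: right_null_def)
    also have "\<dots> = (rmat D + rmat C * K) *\<^sub>v col (rmat H2) j" unfolding G_K ..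
    also have "\<dots> = rmat D *\<^sub>v col (rmat H2) j + rmat C * K *\<^sub>v col (rmat H2) j"
      by (rule add_mult_distrib_mat_vec[OF rcarriers(4) mult_carrier_mat[OF rcarriers(3) K] hc])
    finally have "rmat D *\<^sub>v col (rmat H2) j = - (rmat C * K *\<^sub>v col (rmat H2) j)"
      using mult_mat_vec_carrier[OF rcarriers(4) hc]
        mult_mat_vec_carrier[OF mult_carrier_mat[OF rcarriers(3) K] hc] add_eq_zero_vec_iff by metis
    moreover have "rmat C * (- (K * rmat H2)) = - (rmat C * K * rmat H2)"
      using assoc_mult_mat[OF rcarriers(3) K rH2] mult_uminus_right_mat[OF rcarriers(3) KH] by simp
    moreover have "col (- (rmat C * K * rmat H2)) j = - (rmat C * K *\<^sub>v col (rmat H2) j)"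
      using rcarriers K rH2 j col_mult2[OF mult_carrier_mat[OF rcarriers(3) K] rH2 j]
      by (simp del: col_rmat)
    ultimately show "col (rmat C * (- (K * rmat H2))) j = col (rmat (D * H2)) j"
      unfolding rmat_mult[OF carriers(4) H2] col_mult2[OF rcarriers(4) rH2 j] by simp
  qed (use carriers H2 rH2 in auto)
  then obtain H1 where "H1 \<in> carrier_mat n r" "- (K * rmat H2) = rmat H1"
    using right_coprime_polynomial_mat[OF coprime carriers(1) det_A carriers(3) _ _ AX, of r "D * H2"]
      KH carriers H2 by auto
  then show thesis using that by simp
qed

text \<open>Converse of \<open>poly_basis_lift\<close>: for each column, \<open>null_iff\<close>
  forces the upper part from the lower one, so every polynomial basis of the null space of
  \<open>P\<close> is a lift.\<close>

lemma poly_basis_drop: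
  assumes pb: "poly_basis (n + m) (right_null P) H" and H: "H \<in> carrier_mat (n + m) r"
  obtains H1 H2 where "H1 \<in> carrier_mat n r" "H2 \<in> carrier_mat m r" "H = H1 @\<^sub>r H2"
    "rmat H1 = - (K * rmat H2)"
proof -
  obtain H1 H2 where H12: "H1 \<in> carrier_mat n r" "H2 \<in> carrier_mat m r" "H = H1 @\<^sub>r H2"
    using append_rows_split[OF H] .
  have rc: "rmat H \<in> carrier_mat (n + m) r" "rmat H1 \<in> carrier_mat n r" "rmat H2 \<in> carrier_mat m r"
    using H H12 by auto
  have "rmat H1 = - (K * rmat H2)"
  proof (rule mat_col_eqI)
    fix j assume "j < dim_col (- (K * rmat H2))"
    then have j: "j < r" using rc by simp
    have c: "col (rmat H1) j \<in> carrier_vec n" "col (rmat H2) j \<in> carrier_vec m"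
      using rc j by auto
    have "col (rmat H) j = rmat H *\<^sub>v unit_vec r j" using mult_mat_unit_vec[OF rc(1) j] by simp
    also have "\<dots> = (rmat H1 *\<^sub>v unit_vec r j) @\<^sub>v (rmat H2 *\<^sub>v unit_vec r j)"
      unfolding H12(3) append_rows_rmat[OF H12(1,2)] by (rule mat_mult_append[OF rc(2,3)]) simp
    finally have "col (rmat H) j = col (rmat H1) j @\<^sub>v col (rmat H2) j"
      by (simp only: mult_mat_unit_vec[OF rc(2) j] mult_mat_unit_vec[OF rc(3) j])
    moreover have "col (rmat H) j \<in> right_null P"
      using pb H j by (auto simp: poly_basis_def)
    ultimately have "col (rmat H1) j = - (K *\<^sub>v col (rmat H2) j)"
      using null_iff[OF c] by simp
    also have "\<dots> = col (- (K * rmat H2)) j"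
      using col_mult2[OF K rc(3) j] K rc(3) j by (simp del: col_rmat)
    finally show "col (rmat H1) j = col (- (K * rmat H2)) j" .
  qed (use K rc H12 in auto)
  then show thesis using that H12 by blast
qed

text \<open>Lifting and dropping match the polynomial bases of the two null spaces and keep the
  degree sum. The competitors on both sides thus have the same degree sums.\<close>

lemma minimal_basis_lift_iff:
  assumes "H1 \<in> carrier_mat n r" "H2 \<in> carrier_mat m r" "H = H1 @\<^sub>r H2"
    "rmat H1 = - (K * rmat H2)"
  shows "minimal_basis (n + m) (right_null P) H \<longleftrightarrow> minimal_basis m (right_null G) H2"
proof -
  have "(\<forall>H'. poly_basis (n + m) (right_null P) H' \<longrightarrow> d \<le> degree_sum H') \<longleftrightarrow>
      (\<forall>H2'. poly_basis m (right_null G) H2' \<longrightarrow> d \<le> degree_sum H2')" for d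
  proof (intro iffI allI impI)
    fix H2' assume P: "\<forall>H'. poly_basis (n + m) (right_null P) H' \<longrightarrow> d \<le> degree_sum H'"
      and pb: "poly_basis m (right_null G) H2'"
    obtain s where s: "H2' \<in> carrier_mat m s"
      using pb carrier_matI[OF _ refl] unfolding poly_basis_def by blast
    obtain H1' where H1': "H1' \<in> carrier_mat n s" "rmat H1' = - (K * rmat H2')"
      using poly_basis_lift[OF pb s] .
    show "d \<le> degree_sum H2'"
      using P pb poly_basis_lift_iff[OF H1'(1) s refl H1'(2)] degree_sum_lift[OF H1'(1) s refl H1'(2)]
      by metis
  next
    fix H' assume G: "\<forall>H2'. poly_basis m (right_null G) H2' \<longrightarrow> d \<le> degree_sum H2'"
      and pb: "poly_basis (n + m) (right_null P) H'"
    obtain s where s: "H' \<in> carrier_mat (n + m) s"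
      using pb carrier_matI[OF _ refl] unfolding poly_basis_def by blast
    obtain H1' H2' where H': "H1' \<in> carrier_mat n s" "H2' \<in> carrier_mat m s" "H' = H1' @\<^sub>r H2'"
        "rmat H1' = - (K * rmat H2')"
      using poly_basis_drop[OF pb s] .
    show "d \<le> degree_sum H'"
      using G pb poly_basis_lift_iff[OF H'] degree_sum_lift[OF H'] by metis
  qed
  then show ?thesis
    unfolding minimal_basis_def poly_basis_lift_iff[OF assms] degree_sum_lift[OF assms] by blast
qed

lemma dims: "dim_col P = n + m" "dim_col G = m"
  using P_carrier G by auto

lemma right_minimal_basis_lift:
  assumes "right_minimal_basis G H2"
  obtains H where "rmat H = (- (K * rmat H2)) @\<^sub>r rmat H2" "right_minimal_basis P H"
    "dim_col H = dim_col H2" "\<And>j. j < dim_col H2 \<Longrightarrow> col_degree H j = col_degree H2 j"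
proof -
  have mb: "minimal_basis m (right_null G) H2"
    using assms by (simp add: right_minimal_basis_def dims)
  then have pb: "poly_basis m (right_null G) H2" by (simp add: minimal_basis_def)
  obtain r where r: "H2 \<in> carrier_mat m r"
    using pb carrier_matI[OF _ refl] unfolding poly_basis_def by blast
  obtain H1 where H1: "H1 \<in> carrier_mat n r" "rmat H1 = - (K * rmat H2)"
    using poly_basis_lift[OF pb r] .
  note l = H1(1) r refl H1(2)
  have "right_minimal_basis P (H1 @\<^sub>r H2)"
    using mb minimal_basis_lift_iff[OF l] by (simp add: right_minimal_basis_def dims)
  moreover have "dim_col (H1 @\<^sub>r H2) = r" "dim_col H2 = r" using H1 r by (auto simp: append_rows_def)
  ultimately show thesis
    using that[of "H1 @\<^sub>r H2"] append_rows_rmat[OF l(1,2)] col_degree_lift[OF l] H1(2) by simp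
qed

lemma right_minimal_indices_eq: "right_minimal_indices P = right_minimal_indices G"
\<comment> \<open>\<open>minimal_indices\<close> is defined through \<open>SOME\<close>, so the case
  without any minimal basis is treated separately.\<close>
proof (cases "\<exists>H2. right_minimal_basis G H2")
  case True
  then obtain H2 where H2: "right_minimal_basis G H2" by blast
  obtain H where "rmat H = (- (K * rmat H2)) @\<^sub>r rmat H2" and H: "right_minimal_basis P H"
    "dim_col H = dim_col H2" "\<And>j. j < dim_col H2 \<Longrightarrow> col_degree H j = col_degree H2 j"
    using right_minimal_basis_lift[OF H2] by blast
  have "mset (map (col_degree H) [0..<dim_col H]) = mset (map (col_degree H2) [0..<dim_col H2])"
    using H(2,3) by (intro arg_cong[of _ _ mset] map_cong) auto
  then show ?thesis
    using H(1) H2 minimal_indices_eq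
    unfolding right_minimal_basis_def right_minimal_indices_def by metis
next
  case False
  have "\<not> right_minimal_basis P H" for H
  proof
    assume "right_minimal_basis P H"
    then have mb: "minimal_basis (n + m) (right_null P) H"
      by (simp add: right_minimal_basis_def dims)
    then have pb: "poly_basis (n + m) (right_null P) H" by (simp add: minimal_basis_def)
    obtain r where r: "H \<in> carrier_mat (n + m) r"
      using pb carrier_matI[OF _ refl] unfolding poly_basis_def by blast
    obtain H1 H2 where H': "H1 \<in> carrier_mat n r" "H2 \<in> carrier_mat m r" "H = H1 @\<^sub>r H2"
        "rmat H1 = - (K * rmat H2)"
      using poly_basis_drop[OF pb r] .
    show False
      using False mb minimal_basis_lift_iff[OF H'] by (simp add: right_minimal_basis_def dims)
  qed
  \<comment> \<open>neither side has a minimal basis, so both choices are made from the empty predicate\<close>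
  with False have "minimal_basis (dim_col P) (right_null P) = minimal_basis (dim_col G) (right_null G)"
    by (intro ext) (simp add: right_minimal_basis_def)
  then show ?thesis
    unfolding right_minimal_indices_def minimal_indices_def by (simp only:)
qed

end

section \<open>The transposed system\<close>

text \<open>Left coprimeness of \<open>A\<close> and \<open>B\<close> speaks of the transpose of
  \<open>B\<close>, whereas its negative takes the role of \<open>C\<close> in the transposed
  system. Negating the left factor turns a factorization of \<open>- C\<close> into one of
  \<open>C\<close>.\<close>

lemma right_coprime_uminus:
  assumes cop: "right_coprime A C"
  shows "right_coprime A (- C)"
  unfolding right_coprime_def
proof (intro allI impI)
  fix W assume "common_right_divisor A (- C) W"
  then obtain A' C' where W: "W \<in> carrier_mat (dim_col A) (dim_col A)"
    and A': "A' \<in> carrier_mat (dim_row A) (dim_col A)" "A = A' * W"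
    and C': "C' \<in> carrier_mat (dim_row C) (dim_col A)" "- C = C' * W"
    unfolding common_right_divisor_def index_uminus_mat by blast
  have "C = - (C' * W)" unfolding C'(2)[symmetric] by simp
  then have "C = (- C') * W" unfolding mult_uminus_left_mat[OF C'(1) W] .
  moreover have "- C' \<in> carrier_mat (dim_row C) (dim_col A)"
    using C'(1) uminus_carrier_iff_mat by blast
  ultimately have "common_right_divisor A C W"
    unfolding common_right_divisor_def using W A' by blast
  then show "unimodular W" using cop by (simp add: right_coprime_def)
qed

text \<open>Transposing the system matrix puts the transpose of \<open>- C\<close> at the upper
  right and that of \<open>B\<close> at the lower left. As \<open>system_matrix\<close> negates its
  third argument, both off-diagonal arguments carry a minus sign; the two signs cancel in the
  transfer function.\<close>

lemma transpose_system:
  assumes sys: "is_system_matrix_of G A B C D n m p"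
  shows "is_system_matrix_of (transpose_mat G) (transpose_mat A) (- transpose_mat C)
      (- transpose_mat B) (transpose_mat D) n p m"
    and "inv_mat (rmat (transpose_mat A)) * rmat (- transpose_mat C)
      = - transpose_mat (rmat C * inv_mat (rmat A))"
    and "transpose_mat (rmat (system_matrix A B C D))
      = rmat (system_matrix (transpose_mat A) (- transpose_mat C) (- transpose_mat B) (transpose_mat D))"
proof -
  have c: "A \<in> carrier_mat n n" "B \<in> carrier_mat n m" "C \<in> carrier_mat p n" "D \<in> carrier_mat p m"
    and det_A: "det A \<noteq> 0" and G: "G = rmat D + rmat C * inv_mat (rmat A) * rmat B"
    using sys by (auto simp: is_system_matrix_of_def regular_pmat_def)
  have r: "rmat A \<in> carrier_mat n n" "rmat B \<in> carrier_mat n m"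
    "rmat C \<in> carrier_mat p n" "rmat D \<in> carrier_mat p m"
    using c by auto
  have det_rA: "det (rmat A) \<noteq> 0" using det_A by (simp add: rmat_def)
  note inv = inv_mat[OF r(1) det_rA]
  have invT: "inv_mat (rmat (transpose_mat A)) = transpose_mat (inv_mat (rmat A))"
    unfolding rmat_transpose by (rule inv_mat_transpose[OF r(1) det_rA])
  have CA: "rmat C * inv_mat (rmat A) \<in> carrier_mat p n" using r inv by simp
  show K: "inv_mat (rmat (transpose_mat A)) * rmat (- transpose_mat C)
      = - transpose_mat (rmat C * inv_mat (rmat A))"
    unfolding invT unfolding rmat_uminus rmat_transpose transpose_mult[OF r(3) inv(1)]
    using r(3) inv(1) by (intro mult_uminus_right_mat) auto
  have "transpose_mat G = transpose_mat (rmat D) + transpose_mat (rmat C * inv_mat (rmat A) * rmat B)"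
    unfolding G using r CA by (intro transpose_add) auto
  also have "transpose_mat (rmat C * inv_mat (rmat A) * rmat B)
      = transpose_mat (rmat B) * transpose_mat (rmat C * inv_mat (rmat A))"
    by (rule transpose_mult[OF CA r(2)])
  also have "\<dots> = rmat (- transpose_mat B) *
      (inv_mat (rmat (transpose_mat A)) * rmat (- transpose_mat C))"
    unfolding K unfolding rmat_uminus rmat_transpose
    using mult_uminus_left_mat[of "transpose_mat (rmat B)" m n "- transpose_mat (rmat C * inv_mat (rmat A))" p]
      mult_uminus_right_mat[of "transpose_mat (rmat B)" m n "transpose_mat (rmat C * inv_mat (rmat A))" p]
      r(2) CA by simp
  also have "\<dots> = rmat (- transpose_mat B) * inv_mat (rmat (transpose_mat A)) * rmat (- transpose_mat C)"
    using c inv unfolding invT by (intro assoc_mult_mat[symmetric, of _ m n _ n _ p]) auto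
  finally have GT: "transpose_mat G = rmat (transpose_mat D)
      + rmat (- transpose_mat B) * inv_mat (rmat (transpose_mat A)) * rmat (- transpose_mat C)"
    unfolding rmat_transpose .
  show "is_system_matrix_of (transpose_mat G) (transpose_mat A) (- transpose_mat C)
      (- transpose_mat B) (transpose_mat D) n p m"
    unfolding is_system_matrix_of_def regular_pmat_def using GT c det_A det_transpose[OF c(1)] by auto
  show "transpose_mat (rmat (system_matrix A B C D))
      = rmat (system_matrix (transpose_mat A) (- transpose_mat C) (- transpose_mat B) (transpose_mat D))"
    unfolding system_matrix_def rmat_transpose[symmetric]
    using c by (subst transpose_four_block_mat[of _ n n _ m _ p]) (auto simp: transpose_uminus)
qed

lemma proper_mat_uminus_transpose:
  "proper_mat M \<Longrightarrow> proper_mat (- transpose_mat M)"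
proof -
  have "proper_rat (- x)" if x: "proper_rat x" for x :: "'a::field poly fract"
  proof -
    obtain p q where "q \<noteq> 0" "x = Fract p q" "degree p \<le> degree q"
      using x unfolding proper_rat_def by blast
    then show ?thesis unfolding proper_rat_def by (intro exI[of _ "- p"] exI[of _ q]) simp
  qed
  then show "proper_mat M \<Longrightarrow> proper_mat (- transpose_mat M)"
    by (simp add: proper_mat_def)
qed

theorem theorem3p8:
  fixes G :: "'a::field poly fract mat"
    and A B C D :: "'a poly mat"
    and n m p :: nat
  assumes sys: "is_system_matrix_of G A B C D n m p"
  shows
   "(right_coprime A C \<and> proper_mat (inv_mat (rmat A) * rmat B) \<longrightarrow>
      (\<forall>H2. right_minimal_basis G H2 \<longrightarrow>
         (\<exists>H. rmat H = (- (inv_mat (rmat A) * rmat B * rmat H2)) @\<^sub>r rmat H2 \<and>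
              right_minimal_basis (rmat (system_matrix A B C D)) H))
      \<and> right_minimal_indices (rmat (system_matrix A B C D)) = right_minimal_indices G)
    \<and>
    (left_coprime A B \<and> proper_mat (rmat C * inv_mat (rmat A)) \<longrightarrow>
      (\<forall>H2. left_minimal_basis G H2 \<longrightarrow>
         (\<exists>H. rmat H = (transpose_mat (rmat C * inv_mat (rmat A)) * rmat H2) @\<^sub>r rmat H2 \<and>
              left_minimal_basis (rmat (system_matrix A B C D)) H))
      \<and> left_minimal_indices (rmat (system_matrix A B C D)) = left_minimal_indices G)"
proof (intro conjI[of "_ \<longrightarrow> _"] impI)
  assume "right_coprime A C \<and> proper_mat (inv_mat (rmat A) * rmat B)"
  then interpret coprime_system G A B C D n m p
    using sys by unfold_locales auto
  have "\<exists>H. rmat H = (- (inv_mat (rmat A) * rmat B * rmat H2)) @\<^sub>r rmat H2 \<and>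
      right_minimal_basis (rmat (system_matrix A B C D)) H"
    if "right_minimal_basis G H2" for H2
    using right_minimal_basis_lift[OF that] unfolding K_def P_def by blast
  then show "(\<forall>H2. right_minimal_basis G H2 \<longrightarrow>
         (\<exists>H. rmat H = (- (inv_mat (rmat A) * rmat B * rmat H2)) @\<^sub>r rmat H2 \<and>
              right_minimal_basis (rmat (system_matrix A B C D)) H))
      \<and> right_minimal_indices (rmat (system_matrix A B C D)) = right_minimal_indices G"
    using right_minimal_indices_eq unfolding P_def by blast
next
  assume left: "left_coprime A B \<and> proper_mat (rmat C * inv_mat (rmat A))"
  note T = transpose_system[OF sys]
  interpret coprime_system "transpose_mat G" "transpose_mat A" "- transpose_mat C"
    "- transpose_mat B" "transpose_mat D" n p m
    using T(1) left right_coprime_uminus proper_mat_uminus_transpose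
    by unfold_locales (auto simp: T(2) left_coprime_def)
  have basis: "right_minimal_basis (transpose_mat M) H \<longleftrightarrow> left_minimal_basis M H"
    for M :: "'a poly fract mat" and H
    by (simp add: right_minimal_basis_def left_minimal_basis_def left_null_def)
  have indices: "right_minimal_indices (transpose_mat M) = left_minimal_indices M"
    for M :: "'a poly fract mat"
    by (simp add: right_minimal_indices_def left_minimal_indices_def left_null_def)
  have dims: "rmat C * inv_mat (rmat A) \<in> carrier_mat p n" "dim_row G = p"
    using K dims(2) unfolding K_def T(2) by auto
  \<comment> \<open>For the transposed system \<open>K\<close> is minus the transpose of
    \<open>rmat C * inv_mat (rmat A)\<close>, which cancels the minus sign of the lift. This is why
    part (b) has no sign.\<close>
  have lift: "- (K * rmat H2) = transpose_mat (rmat C * inv_mat (rmat A)) * rmat H2"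
    if "left_minimal_basis G H2" for H2
  proof -
    have "rmat H2 \<in> carrier_mat p (dim_col H2)"
      using that dims(2)
      by (intro carrier_matI) (simp_all add: left_minimal_basis_def minimal_basis_def poly_basis_def)
    from mult_uminus_left_mat[OF _ this, of "transpose_mat (rmat C * inv_mat (rmat A))" n]
    show ?thesis using dims(1) unfolding K_def T(2) by simp
  qed
  have P: "P = transpose_mat (rmat (system_matrix A B C D))"
    unfolding P_def T(3) ..
  have "\<exists>H. rmat H = (transpose_mat (rmat C * inv_mat (rmat A)) * rmat H2) @\<^sub>r rmat H2 \<and>
      left_minimal_basis (rmat (system_matrix A B C D)) H"
    if "left_minimal_basis G H2" for H2
  proof -
    have "right_minimal_basis (transpose_mat G) H2" using that by (simp only: basis)
    then obtain H where "rmat H = (- (K * rmat H2)) @\<^sub>r rmat H2" "right_minimal_basis P H"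
      using right_minimal_basis_lift by blast
    then show ?thesis unfolding lift[OF that] P basis by blast
  qed
  then show "(\<forall>H2. left_minimal_basis G H2 \<longrightarrow>
         (\<exists>H. rmat H = (transpose_mat (rmat C * inv_mat (rmat A)) * rmat H2) @\<^sub>r rmat H2 \<and>
              left_minimal_basis (rmat (system_matrix A B C D)) H))
      \<and> left_minimal_indices (rmat (system_matrix A B C D)) = left_minimal_indices G"
    using right_minimal_indices_eq unfolding P indices by blast
qed

end
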